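(* Let $\mathbb{F}$ be a field with $\mathrm{char}(\mathbb{F})\neq2$, let $E\neq0$ be a vector space over $\mathbb{F}$ with a symmetric bilinear form $b\colon E\times E\to\mathbb{F}$ such that $E$ is spanned by vectors $e$ with $b(e,e)=1$, and let $\alpha\in\mathbb{F}\setminus\{0,1,\frac12\}$. Then the split spin factor algebra $S(b,\alpha)$ is simple if and only if $b$ is non-degenerate and $\alpha\notin\{-1,2\}$.
   Context: The split spin factor $S(b,\alpha)$ is the commutative (not necessarily associative) algebra on the vector space $E\oplus\mathbb{F}z_1\oplus\mathbb{F}z_2$ with multiplication $z_1^2=z_1$, $z_2^2=z_2$, $z_1z_2=0$, $ez_1=\alpha e$, $ez_2=(1-\alpha)e$, $ef=-b(e,f)z$ for all $e,f\in E$, where $z:=\alpha(\alpha-2)z_1+(\alpha-1)(\alpha+1)z_2$. Simple means having no ideals other than $0$ and the whole algebra. The form $b$ is non-degenerate if $\{u\in E: b(u,v)=0\text{ for all }v\in E\}=0$. *)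

theory Defs
  imports Complex_Main "HOL-Library.Product_Plus"
begin

text \<open>An algebra is given by a scalar multiplication \<open>s\<close> and a (not necessarily associative)
  product \<open>m\<close> on a whole type; ideals are two-sided and are linear subspaces.\<close>

definition algebra_ideal ::
    "('k::field \<Rightarrow> 'a::ab_group_add \<Rightarrow> 'a) \<Rightarrow> ('a \<Rightarrow> 'a \<Rightarrow> 'a) \<Rightarrow> 'a set \<Rightarrow> bool" where
  "algebra_ideal s m I \<longleftrightarrow>
     module.subspace s I \<and> (\<forall>x\<in>I. \<forall>a. m a x \<in> I \<and> m x a \<in> I)"

definition simple_algebra ::
    "('k::field \<Rightarrow> 'a::ab_group_add \<Rightarrow> 'a) \<Rightarrow> ('a \<Rightarrow> 'a \<Rightarrow> 'a) \<Rightarrow> bool" where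
  "simple_algebra s m \<longleftrightarrow> (\<forall>I. algebra_ideal s m I \<longrightarrow> I = {0} \<or> I = UNIV)"

definition symmetric_bilinear_form ::
    "('k::field \<Rightarrow> 'e::ab_group_add \<Rightarrow> 'e) \<Rightarrow> ('e \<Rightarrow> 'e \<Rightarrow> 'k) \<Rightarrow> bool" where
  "symmetric_bilinear_form s b \<longleftrightarrow>
     (\<forall>u. Vector_Spaces.linear s (*) (\<lambda>v. b u v)) \<and>
     (\<forall>v. Vector_Spaces.linear s (*) (\<lambda>u. b u v)) \<and>
     (\<forall>u v. b u v = b v u)"

definition nondegenerate_form :: "('e::zero \<Rightarrow> 'e \<Rightarrow> 'k::zero) \<Rightarrow> bool" where
  "nondegenerate_form b \<longleftrightarrow> {u. \<forall>v. b u v = 0} = {0}"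

text \<open>The triple \<open>(e, x, y)\<close> stands for \<open>e + x z\<^sub>1 + y z\<^sub>2\<close>. Addition on triples is the
  componentwise one of the product type.\<close>

type_synonym ('e, 'k) split_spin = "'e \<times> 'k \<times> 'k"

fun split_spin_scale ::
    "('k::field \<Rightarrow> 'e \<Rightarrow> 'e) \<Rightarrow> 'k \<Rightarrow> ('e, 'k) split_spin \<Rightarrow> ('e, 'k) split_spin" where
  "split_spin_scale s c (e, x, y) = (s c e, c * x, c * y)"

definition split_spin_E :: "'e \<Rightarrow> ('e, 'k::field) split_spin" where
  "split_spin_E e = (e, 0, 0)"

definition split_spin_z1 :: "('e::zero, 'k::field) split_spin" where
  "split_spin_z1 = (0, 1, 0)"

definition split_spin_z2 :: "('e::zero, 'k::field) split_spin" where
  "split_spin_z2 = (0, 0, 1)"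

definition split_spin_z :: "'k::field \<Rightarrow> ('e::zero, 'k) split_spin" where
  "split_spin_z \<alpha> = (0, \<alpha> * (\<alpha> - 2), (\<alpha> - 1) * (\<alpha> + 1))"

text \<open>The product is the bilinear extension of the multiplication table, which is recovered in
  \<open>split_spin_mult_table\<close> below.\<close>

fun split_spin_mult ::
    "('k::field \<Rightarrow> 'e::ab_group_add \<Rightarrow> 'e) \<Rightarrow> ('e \<Rightarrow> 'e \<Rightarrow> 'k) \<Rightarrow> 'k \<Rightarrow>
     ('e, 'k) split_spin \<Rightarrow> ('e, 'k) split_spin \<Rightarrow> ('e, 'k) split_spin" where
  "split_spin_mult s b \<alpha> (e, x1, x2) (f, y1, y2) =
     (s (\<alpha> * y1 + (1 - \<alpha>) * y2) e + s (\<alpha> * x1 + (1 - \<alpha>) * x2) f, x1 * y1, x2 * y2)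
       - split_spin_scale s (b e f) (split_spin_z \<alpha>)"

lemma vector_space_split_spin:
  assumes "vector_space s"
  shows "vector_space (split_spin_scale s)"
proof -
  interpret vector_space s by fact
  show ?thesis
    by unfold_locales (auto simp: algebra_simps)
qed

lemma
  assumes "symmetric_bilinear_form s b"
  shows split_spin_mult_commute:
      "split_spin_mult s b \<alpha> u v = split_spin_mult s b \<alpha> v u"
    and linear_split_spin_mult:
      "Vector_Spaces.linear (split_spin_scale s) (split_spin_scale s) (split_spin_mult s b \<alpha> u)"
proof -
  have lin: "Vector_Spaces.linear s (*) (b e)" and sym: "b e f = b f e" for e f
    using assms by (auto simp: symmetric_bilinear_form_def)
  interpret vector_space s
    using lin by (auto simp: Vector_Spaces.linear_def)
  have add: "b e (f + g) = b e f + b e g" and scale: "b e (s c f) = c * b e f" for e f g c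
    using lin[of e] by (auto simp: linear_iff_module_hom module_hom.add module_hom.scale)
  show "split_spin_mult s b \<alpha> u v = split_spin_mult s b \<alpha> v u"
    by (cases u; cases v) (auto simp: sym split_spin_z_def algebra_simps)
  interpret S: vector_space "split_spin_scale s"
    by (rule vector_space_split_spin) unfold_locales
  show "Vector_Spaces.linear (split_spin_scale s) (split_spin_scale s) (split_spin_mult s b \<alpha> u)"
    unfolding linear_iff_module_hom module_hom_iff using S.module_axioms
    by (cases u) (auto simp: split_spin_z_def add scale algebra_simps)
qed

lemma split_spin_mult_table:
  fixes s :: "'k::field \<Rightarrow> 'e::ab_group_add \<Rightarrow> 'e"
  assumes "symmetric_bilinear_form s b"
  shows "split_spin_mult s b \<alpha> split_spin_z1 split_spin_z1 = split_spin_z1"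
    and "split_spin_mult s b \<alpha> split_spin_z2 split_spin_z2 = split_spin_z2"
    and "split_spin_mult s b \<alpha> split_spin_z1 split_spin_z2 = 0"
    and "split_spin_mult s b \<alpha> (split_spin_E e) split_spin_z1
           = split_spin_scale s \<alpha> (split_spin_E e)"
    and "split_spin_mult s b \<alpha> (split_spin_E e) split_spin_z2
           = split_spin_scale s (1 - \<alpha>) (split_spin_E e)"
    and "split_spin_mult s b \<alpha> (split_spin_E e) (split_spin_E f)
           = split_spin_scale s (- b e f) (split_spin_z \<alpha>)"
    and "split_spin_z \<alpha> = split_spin_scale s (\<alpha> * (\<alpha> - 2)) split_spin_z1
           + split_spin_scale s ((\<alpha> - 1) * (\<alpha> + 1)) (split_spin_z2 :: ('e, 'k) split_spin)"
    and "(e, x, y) = split_spin_E e + split_spin_scale s x split_spin_z1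
           + split_spin_scale s y split_spin_z2"
proof -
  have lin: "Vector_Spaces.linear s (*) (b e)" and sym: "b e f = b f e" for e f
    using assms by (auto simp: symmetric_bilinear_form_def)
  interpret vector_space s
    using lin by (auto simp: Vector_Spaces.linear_def)
  have b0: "b e 0 = 0" "b 0 e = 0" for e
    using lin[of e] sym[of 0 e] by (auto simp: linear_iff_module_hom module_hom.zero)
  note defs = split_spin_z_def split_spin_z1_def split_spin_z2_def split_spin_E_def zero_prod_def
  show "split_spin_mult s b \<alpha> split_spin_z1 split_spin_z1 = split_spin_z1"
    "split_spin_mult s b \<alpha> split_spin_z2 split_spin_z2 = split_spin_z2"
    "split_spin_mult s b \<alpha> split_spin_z1 split_spin_z2 = 0"
    "split_spin_mult s b \<alpha> (split_spin_E e) split_spin_z1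
       = split_spin_scale s \<alpha> (split_spin_E e)"
    "split_spin_mult s b \<alpha> (split_spin_E e) split_spin_z2
       = split_spin_scale s (1 - \<alpha>) (split_spin_E e)"
    "split_spin_mult s b \<alpha> (split_spin_E e) (split_spin_E f)
       = split_spin_scale s (- b e f) (split_spin_z \<alpha>)"
    "split_spin_z \<alpha> = split_spin_scale s (\<alpha> * (\<alpha> - 2)) split_spin_z1
       + split_spin_scale s ((\<alpha> - 1) * (\<alpha> + 1)) (split_spin_z2 :: ('e, 'k) split_spin)"
    "(e, x, y) = split_spin_E e + split_spin_scale s x split_spin_z1
       + split_spin_scale s y split_spin_z2"
    by (simp_all add: defs b0)
qed

end

theory Submission
  imports Defs
begin

text \<open>The proper ideals of \<open>S(b,\<alpha>)\<close> are governed by the radical of \<open>b\<close> and by the two coordinates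
  \<open>\<alpha>(\<alpha> - 2)\<close> and \<open>(\<alpha> - 1)(\<alpha> + 1)\<close> of \<open>z\<close>. The radical, sitting inside \<open>E\<close>, is an ideal because
  its elements multiply \<open>E\<close> to \<open>0\<close>. If \<open>\<alpha> = 2\<close> then \<open>z\<close> is a multiple of \<open>z\<^sub>2\<close>, so \<open>E + \<langle>z\<^sub>2\<rangle>\<close> is an
  ideal; if \<open>\<alpha> = -1\<close> then \<open>z\<close> is a multiple of \<open>z\<^sub>1\<close>, so \<open>E + \<langle>z\<^sub>1\<rangle>\<close> is one.

  Conversely, multiplication by \<open>z\<^sub>1\<close> has eigenvalues \<open>\<alpha>\<close>, \<open>1\<close>, \<open>0\<close> on \<open>E\<close>, \<open>\<langle>z\<^sub>1\<rangle>\<close>, \<open>\<langle>z\<^sub>2\<rangle>\<close>, and these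
  are distinct, so an ideal contains the three components of each of its elements
  (\<open>components_in_ideal\<close>). An ideal that meets \<open>E\<close> in a vector outside the radical contains \<open>z\<close>,
  hence both idempotents when the coordinates of \<open>z\<close> are nonzero, hence everything
  (\<open>ideal_eq_UNIV_if_nonradical\<close>). An ideal containing \<open>z\<^sub>1\<close> or \<open>z\<^sub>2\<close> contains \<open>E\<close>, as \<open>\<alpha>\<close> and
  \<open>1 - \<alpha>\<close> are nonzero; when \<open>b\<close> is non-degenerate on \<open>E \<noteq> 0\<close> this is the previous case.\<close>

text \<open>The setting of \<open>S(b,\<alpha>)\<close> over an arbitrary field: \<open>b\<close> is a symmetric bilinear form on \<open>E\<close>, with
  no restriction on the parameter \<open>\<alpha>\<close>.\<close>

locale split_spin_algebra = vector_space scale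
  for scale :: "'k::field \<Rightarrow> 'e::ab_group_add \<Rightarrow> 'e" +
  fixes b :: "'e \<Rightarrow> 'e \<Rightarrow> 'k" and \<alpha> :: 'k
  assumes form: "symmetric_bilinear_form scale b"
begin

sublocale S: vector_space "split_spin_scale scale"
  by (rule vector_space_split_spin) unfold_locales

abbreviation mult (infixl "\<odot>" 70) where
  "u \<odot> v \<equiv> split_spin_mult scale b \<alpha> u v"

abbreviation is_ideal :: "('e, 'k) split_spin set \<Rightarrow> bool" where
  "is_ideal \<equiv> algebra_ideal (split_spin_scale scale) (split_spin_mult scale b \<alpha>)"

lemma form_simps [simp]:
  "b (u + v) w = b u w + b v w" "b (scale c u) w = c * b u w" "b 0 w = 0"
  "b w (u + v) = b w u + b w v" "b w (scale c u) = c * b w u" "b w 0 = 0"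
proof -
  have l: "Vector_Spaces.linear scale (*) (b w)"
    and r: "Vector_Spaces.linear scale (*) (\<lambda>u. b u w)"
    using form by (auto simp: symmetric_bilinear_form_def)
  show "b w (u + v) = b w u + b w v" "b w (scale c u) = c * b w u" "b w 0 = 0"
    using l by (auto simp: linear_iff_module_hom module_hom.add module_hom.scale module_hom.zero)
  show "b (u + v) w = b u w + b v w" "b (scale c u) w = c * b u w" "b 0 w = 0"
    using module_hom.add[of scale "(*)" "\<lambda>u. b u w"] module_hom.scale[of scale "(*)" "\<lambda>u. b u w"]
      module_hom.zero[of scale "(*)" "\<lambda>u. b u w"] r by (auto simp: linear_iff_module_hom)
qed

lemma mult_eq:
  "(e, x1, x2) \<odot> (f, y1, y2) =
    (scale (\<alpha> * y1 + (1 - \<alpha>) * y2) e + scale (\<alpha> * x1 + (1 - \<alpha>) * x2) f,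
     x1 * y1 - b e f * (\<alpha> * (\<alpha> - 2)), x2 * y2 - b e f * ((\<alpha> - 1) * (\<alpha> + 1)))"
  by (simp add: split_spin_z_def)

lemma is_idealI:
  assumes "0 \<in> I" "\<And>u v. u \<in> I \<Longrightarrow> v \<in> I \<Longrightarrow> u + v \<in> I"
    and "\<And>c u. u \<in> I \<Longrightarrow> split_spin_scale scale c u \<in> I"
    and "\<And>u v. u \<in> I \<Longrightarrow> u \<odot> v \<in> I"
  shows "is_ideal I"
  using assms split_spin_mult_commute[OF form, of \<alpha>]
  unfolding algebra_ideal_def S.subspace_def by metis

lemma
  assumes "is_ideal I"
  shows ideal_add: "u \<in> I \<Longrightarrow> v \<in> I \<Longrightarrow> u + v \<in> I"
    and ideal_diff: "u \<in> I \<Longrightarrow> v \<in> I \<Longrightarrow> u - v \<in> I"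
    and ideal_mult: "u \<in> I \<Longrightarrow> u \<odot> v \<in> I"
    and ideal_zero: "0 \<in> I"
  using assms S.subspace_add S.subspace_diff S.subspace_0
  unfolding algebra_ideal_def by blast+

lemma ideal_scaleD:
  assumes "is_ideal I" "split_spin_scale scale c u \<in> I" "c \<noteq> 0"
  shows "u \<in> I"
proof -
  have "split_spin_scale scale (inverse c) (split_spin_scale scale c u) \<in> I"
    using assms S.subspace_scale unfolding algebra_ideal_def by blast
  then show ?thesis
    using \<open>c \<noteq> 0\<close> by simp
qed

lemma ideal_scale:
  assumes "is_ideal I" "u \<in> I"
  shows "split_spin_scale scale c u \<in> I"
  using assms S.subspace_scale unfolding algebra_ideal_def by blast

lemma radical_ideal: "is_ideal ({u. \<forall>v. b u v = 0} \<times> {0})"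
  by (rule is_idealI) (auto simp: mult_eq zero_prod_def simp del: split_spin_mult.simps)

lemma ideal_E_z2: "\<alpha> = 2 \<Longrightarrow> is_ideal {(e, x, y). x = 0}"
  by (rule is_idealI) (auto simp: split_spin_z_def zero_prod_def)

lemma ideal_E_z1: "\<alpha> = -1 \<Longrightarrow> is_ideal {(e, x, y). y = 0}"
  by (rule is_idealI) (auto simp: split_spin_z_def zero_prod_def)

lemma components_in_ideal:
  assumes I: "is_ideal I" and u: "(e, x, y) \<in> I" and \<alpha>: "\<alpha> \<noteq> 0" "\<alpha> \<noteq> 1"
  shows "(e, 0, 0) \<in> I" "(0, x, 0) \<in> I" "(0, 0, y) \<in> I"
proof -
  let ?z1 = "(0, 1, 0) :: ('e, 'k) split_spin"
  have 1: "(scale \<alpha> e, x, 0) \<in> I"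
    using ideal_mult[OF I u, of ?z1] by (simp add: mult_eq del: split_spin_mult.simps)
  have 2: "(scale (\<alpha> * \<alpha>) e, x, 0) \<in> I"
    using ideal_mult[OF I 1, of ?z1] by (simp add: mult_eq del: split_spin_mult.simps)
  \<comment> \<open>Multiplying by \<open>z\<^sub>1\<close> again fixes the \<open>z\<^sub>1\<close>-component, so the difference lies in \<open>E\<close>.\<close>
  have "split_spin_scale scale (\<alpha> * (\<alpha> - 1)) (e, 0, 0) \<in> I"
    using ideal_diff[OF I 2 1] by (simp add: algebra_simps zero_prod_def)
  then show e: "(e, 0, 0) \<in> I"
    by (rule ideal_scaleD[OF I]) (use \<alpha> in auto)
  show x: "(0, x, 0) \<in> I"
    using ideal_diff[OF I 1 ideal_scale[OF I e, of \<alpha>]] by simp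
  show "(0, 0, y) \<in> I"
    using ideal_diff[OF I ideal_diff[OF I u e] x] by simp
qed

text \<open>The element \<open>x z\<^sub>1 + y z\<^sub>2\<close> acts on \<open>E\<close> as the scalar \<open>\<alpha>x + (1 - \<alpha>)y\<close>.\<close>

lemma E_in_ideal:
  assumes I: "is_ideal I" and z: "(0, x, y) \<in> I" and c: "\<alpha> * x + (1 - \<alpha>) * y \<noteq> 0"
  shows "(f, 0, 0) \<in> I"
proof (rule ideal_scaleD[OF I _ c])
  show "split_spin_scale scale (\<alpha> * x + (1 - \<alpha>) * y) (f, 0, 0) \<in> I"
    using ideal_mult[OF I z, of "(f, 0, 0)"] by (simp add: mult_eq del: split_spin_mult.simps)
qed

lemma ideal_eq_UNIV_if_nonradical:
  assumes I: "is_ideal I" and e: "(e, 0, 0) \<in> I" and ef: "b e f \<noteq> 0"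
    and \<alpha>: "\<alpha> \<notin> {0, 1, -1, 2}"
  shows "I = UNIV"
proof -
  have \<alpha>1: "\<alpha> \<noteq> 0" "\<alpha> \<noteq> 1"
    using \<alpha> by auto
  have "split_spin_scale scale (- b e f) (0, \<alpha> * (\<alpha> - 2), (\<alpha> - 1) * (\<alpha> + 1)) \<in> I"
    using ideal_mult[OF I e, of "(f, 0, 0)"] by (simp add: mult_eq del: split_spin_mult.simps)
  then have z: "(0, \<alpha> * (\<alpha> - 2), (\<alpha> - 1) * (\<alpha> + 1)) \<in> I"
    by (rule ideal_scaleD[OF I]) (use ef in simp)
  have nz: "\<alpha> * (\<alpha> - 2) \<noteq> 0" "(\<alpha> - 1) * (\<alpha> + 1) \<noteq> 0"
    using \<alpha> by (auto simp: add_eq_0_iff2)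
  have z1: "(0, 1, 0) \<in> I"
    by (rule ideal_scaleD[OF I _ nz(1)]) (use components_in_ideal(2)[OF I z \<alpha>1] in simp)
  have z2: "(0, 0, 1) \<in> I"
    by (rule ideal_scaleD[OF I _ nz(2)]) (use components_in_ideal(3)[OF I z \<alpha>1] in simp)
  have "(g, x, y) \<in> I" for g x y
  proof -
    have "(g, 0, 0) \<in> I"
      by (rule E_in_ideal[OF I z1]) (use \<alpha> in auto)
    from ideal_add[OF I ideal_add[OF I this ideal_scale[OF I z1, of x]] ideal_scale[OF I z2, of y]]
    show ?thesis
      by simp
  qed
  then show ?thesis
    by auto
qed

lemma simple_imp:
  assumes "simple_algebra (split_spin_scale scale) (split_spin_mult scale b \<alpha>)"
  shows "nondegenerate_form b \<and> \<alpha> \<notin> {-1, 2}"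
proof -
  have zero: "u = 0" if "is_ideal I" "v \<notin> I" "u \<in> I" for I u v
    using assms that unfolding simple_algebra_def by blast
  have "u = 0" if "\<forall>v. b u v = 0" for u
    using zero[OF radical_ideal, of "(0, 1, 0)" "(u, 0, 0)"] that by (simp add: zero_prod_def)
  then have "nondegenerate_form b"
    unfolding nondegenerate_form_def by auto
  moreover have "\<alpha> \<noteq> 2"
    using zero[OF ideal_E_z2, of "(0, 1, 0)" "(0, 0, 1)"] by (auto simp: zero_prod_def)
  moreover have "\<alpha> \<noteq> -1"
    using zero[OF ideal_E_z1, of "(0, 0, 1)" "(0, 1, 0)"] by (auto simp: zero_prod_def)
  ultimately show ?thesis
    by simp
qed

lemma simple_if:
  assumes nondeg: "nondegenerate_form b" and E: "\<exists>e::'e. e \<noteq> 0"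
    and \<alpha>: "\<alpha> \<notin> {0, 1, -1, 2}"
  shows "simple_algebra (split_spin_scale scale) (split_spin_mult scale b \<alpha>)"
  unfolding simple_algebra_def
proof (intro allI impI)
  fix I
  assume I: "is_ideal I"
  have full: "I = UNIV" if "(e, 0, 0) \<in> I" "e \<noteq> 0" for e
  proof -
    obtain f where "b e f \<noteq> 0"
      using nondeg \<open>e \<noteq> 0\<close> unfolding nondegenerate_form_def by blast
    then show ?thesis
      using ideal_eq_UNIV_if_nonradical[OF I that(1) _ \<alpha>] by blast
  qed
  show "I = {0} \<or> I = UNIV"
  proof (cases "I \<subseteq> {0}")
    case True
    then show ?thesis
      using ideal_zero[OF I] by blast
  next
    case False
    then obtain e x y where u: "(e, x, y) \<in> I" "(e, x, y) \<noteq> 0"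
      by (metis prod_cases3 singletonI subsetI)
    have comps: "(e, 0, 0) \<in> I" "(0, x, 0) \<in> I" "(0, 0, y) \<in> I"
      using components_in_ideal[OF I u(1)] \<alpha> by auto
    obtain f :: 'e where f: "f \<noteq> 0"
      using E by blast
    consider "e \<noteq> 0" | "x \<noteq> 0" | "y \<noteq> 0"
      using u(2) by (auto simp: zero_prod_def)
    then have "I = UNIV"
    proof cases
      case 1
      then show ?thesis
        using full comps(1) by blast
    next
      case 2
      then have "(f, 0, 0) \<in> I"
        using E_in_ideal[OF I comps(2)] \<alpha> by simp
      then show ?thesis
        using full f by blast
    next
      case 3
      then have "(f, 0, 0) \<in> I"
        using E_in_ideal[OF I comps(3)] \<alpha> by simp
      then show ?thesis
        using full f by blast
    qed
    then show ?thesis ..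
  qed
qed

end

theorem theorem3:
  fixes scale :: "'k::field \<Rightarrow> 'e::ab_group_add \<Rightarrow> 'e"
    and b :: "'e \<Rightarrow> 'e \<Rightarrow> 'k"
    and \<alpha> :: 'k
  assumes "CHAR('k) \<noteq> 2"
    and "vector_space scale"
    and "\<exists>e::'e. e \<noteq> 0"
    and "symmetric_bilinear_form scale b"
    and "module.span scale {e. b e e = 1} = UNIV"
    and "\<alpha> \<notin> {0, 1, 1 / 2}"
  shows "simple_algebra (split_spin_scale scale) (split_spin_mult scale b \<alpha>)
     \<longleftrightarrow> nondegenerate_form b \<and> \<alpha> \<notin> {-1, 2}"
proof -
  interpret split_spin_algebra scale b \<alpha>
    using assms(2,4) by (simp add: split_spin_algebra_def split_spin_algebra_axioms_def)
  show ?thesis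
    using simple_imp simple_if assms(3,6) by blast
qed

end
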